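(* Consider a decentralized shortest path interdiction (DSPI) game with continuous interdiction in which each agent $f\in\mathcal F$, given the other agents' decisions $x^{-f}$, solves $$\max_{x^f}\ \theta^f(x^f,x^{-f})=\min_{p\in P^f}\ \sum_{(u,v)\in p}\Big(d^0_{uv}+\sum_{g\in\mathcal F}x^g_{uv}\Big)\quad\text{subject to}\quad \sum_{(u,v)\in A}c^f_{uv}x^f_{uv}\le b^f,\quad x^f\in X^f .$$ Assume that for each $f\in\mathcal F$ the set $X^f\subset\mathbb R^{|A|}$ is nonempty, convex and compact, and that each agent's feasible set $\{x^f\in X^f:\sum_{(u,v)\in A}c^f_{uv}x^f_{uv}\le b^f\}$ is nonempty. Then the game has a pure strategy Nash equilibrium.
   Context: $G=(V,A)$ is a finite directed network and $\mathcal F=\{1,\dots,F\}$ is a finite set of agents (interdictors). Agent $f$ has a source node $s^f\in V$, a target node $t^f\in V$, a budget $b^f>0$ and arc interdiction costs $c^f_{uv}>0$ for $(u,v)\in A$. $P^f$ is the (finite, nonempty) set of directed $s^f$-$t^f$ paths in $G$. The initial arc lengths satisfy $d^0_{uv}>0$. $x^f=(x^f_{uv})_{(u,v)\in A}$ is agent $f$'s decision vector and $x^{-f}$ denotes the decisions of all agents other than $f$. A pure strategy Nash equilibrium is a profile $(x^1,\dots,x^F)$ such that, for every $f$, $x^f$ is an optimal solution of agent $f$'s problem given $x^{-f}$. *)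

theory Defs
  imports "HOL-Analysis.Analysis" "Graph_Theory.Pair_Digraph"
begin

text \<open>
  The arc set \<open>A\<close> of a network is a set of pairs over a finite type \<open>'v\<close>, and
  \<open>\<real>\<^sup>A\<close> is represented as the coordinate subspace of \<open>real ^ ('v \<times> 'v)\<close> consisting of
  the vectors that vanish off \<open>A\<close>, so that the library notions \<^const>\<open>convex\<close> and
  \<^const>\<open>compact\<close> apply.
\<close>

definition arc_vectors :: "('v :: finite \<times> 'v) set \<Rightarrow> (real ^ ('v \<times> 'v)) set" where
  "arc_vectors A = {x. \<forall>a. a \<notin> A \<longrightarrow> x $ a = 0}"

text \<open>Paths have pairwise distinct vertices and are given by their lists of arcs.\<close>

definition st_paths :: "'v pair_pre_digraph \<Rightarrow> 'v \<Rightarrow> 'v \<Rightarrow> ('v \<times> 'v) list set" where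
  "st_paths G s t = {p. pre_digraph.apath (with_proj G) s p t}"

definition payoff ::
  "'v pair_pre_digraph \<Rightarrow> ('v \<times> 'v \<Rightarrow> real) \<Rightarrow> ('f :: finite \<Rightarrow> 'v) \<Rightarrow> ('f \<Rightarrow> 'v) \<Rightarrow>
    'f \<Rightarrow> ('f \<Rightarrow> real ^ ('v :: finite \<times> 'v)) \<Rightarrow> real"
where
  "payoff G d0 s t f x =
    Min ((\<lambda>p. \<Sum>a\<leftarrow>p. d0 a + (\<Sum>g\<in>UNIV. x g $ a)) ` st_paths G (s f) (t f))"

definition feasible ::
  "'v pair_pre_digraph \<Rightarrow> ('f \<Rightarrow> 'v \<times> 'v \<Rightarrow> real) \<Rightarrow> ('f \<Rightarrow> real) \<Rightarrow>
    ('f \<Rightarrow> (real ^ ('v :: finite \<times> 'v)) set) \<Rightarrow> 'f \<Rightarrow> (real ^ ('v \<times> 'v)) set"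
where
  "feasible G c b X f = {y \<in> X f. (\<Sum>a\<in>parcs G. c f a * y $ a) \<le> b f}"

definition pure_nash_equilibrium ::
  "('f \<Rightarrow> 's set) \<Rightarrow> ('f \<Rightarrow> ('f \<Rightarrow> 's) \<Rightarrow> real) \<Rightarrow> ('f \<Rightarrow> 's) \<Rightarrow> bool"
where
  "pure_nash_equilibrium S \<theta> x \<longleftrightarrow>
    (\<forall>f. is_arg_max (\<lambda>y. \<theta> f (x(f := y))) (\<lambda>y. y \<in> S f) (x f))"

end

theory Submission
  imports Defs
begin

text \<open>
  Each payoff is a minimum of finitely many affine functions, hence jointly continuous and
  concave in the agent's own decision. For such a game, a profile \<open>x\<close> is an equilibrium as soon as
  it satisfies \<open>\<Phi> x y \<le> \<Phi> x x\<close> for all feasible \<open>y\<close>, where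
  \<open>\<Phi> x y = (\<Sum>f\<in>UNIV. \<theta> f (x(f := y f)))\<close> is the Nikaido--Isoda function, and Ky Fan's
  inequality, a consequence of Brouwer's theorem, provides such an \<open>x\<close>.
\<close>

text \<open>
  If every \<open>x\<close> had some \<open>y\<close> with \<open>\<phi> x y > 0\<close>, finitely many such \<open>y\<close> would serve all \<open>x\<close>.
  Averaging them with weights \<open>max 0 (\<phi> x y)\<close> gives a continuous self-map of \<open>K\<close>; at
  a fixed point \<open>x\<close> of it, \<open>x\<close> is a convex combination of points \<open>y\<close> with \<open>\<phi> x y > 0\<close>,
  which contradicts \<open>\<phi> x x \<le> 0\<close>.
\<close>

lemma Ky_Fan_inequality:
  fixes K :: "'a::euclidean_space set" and \<phi> :: "'a \<Rightarrow> 'a \<Rightarrow> real"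
  assumes K: "compact K" "convex K" "K \<noteq> {}"
    and cont: "\<And>y. y \<in> K \<Longrightarrow> continuous_on K (\<lambda>x. \<phi> x y)"
    and conv: "\<And>x. x \<in> K \<Longrightarrow> convex {y \<in> K. \<phi> x y > 0}"
    and diag: "\<And>x. x \<in> K \<Longrightarrow> \<phi> x x \<le> 0"
  shows "\<exists>x\<in>K. \<forall>y\<in>K. \<phi> x y \<le> 0"
proof (rule ccontr)
  assume "\<not> ?thesis"
  then have ex: "\<exists>y\<in>K. \<phi> x y > 0" if "x \<in> K" for x
    using that by (auto simp: not_le)
  define U where "U y = {x \<in> K. \<phi> x y > 0}" for y
  have "openin (top_of_set K) (U y)" if "y \<in> K" for y
    using continuous_openin_preimage_gen[OF cont[OF that] open_greaterThan[of 0]]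
    by (simp add: U_def vimage_def Int_def)
  moreover have "K \<subseteq> \<Union> (U ` K)"
    using ex by (auto simp: U_def)
  ultimately obtain D where "D \<subseteq> U ` K" "finite D" "K \<subseteq> \<Union> D"
    using K(1)[unfolded compact_eq_openin_cover] by (metis (no_types, lifting) imageE)
  then obtain Y where Y: "Y \<subseteq> K" "finite Y" "K \<subseteq> \<Union> (U ` Y)"
    by (metis finite_subset_image)
  define \<beta> where "\<beta> x y = max 0 (\<phi> x y)" for x y
  define \<sigma> where "\<sigma> x = (\<Sum>y\<in>Y. \<beta> x y)" for x
  define h where "h x = (\<Sum>y\<in>Y. (\<beta> x y / \<sigma> x) *\<^sub>R y)" for x
  have \<beta>_nonneg: "\<beta> x y \<ge> 0" for x y
    by (simp add: \<beta>_def)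
  have \<sigma>_pos: "\<sigma> x > 0" if x: "x \<in> K" for x
  proof -
    obtain y where "y \<in> Y" "\<phi> x y > 0"
      using Y(3) x by (auto simp: U_def)
    then show ?thesis
      unfolding \<sigma>_def using \<open>finite Y\<close> \<beta>_nonneg by (intro sum_pos2[of Y y]) (auto simp: \<beta>_def)
  qed
  have weights: "(\<Sum>y\<in>Y. \<beta> x y / \<sigma> x) = 1" if "x \<in> K" for x
    using \<sigma>_pos[OF that] by (simp add: \<sigma>_def flip: sum_divide_distrib)
  have cont_\<beta>: "continuous_on K (\<lambda>x. \<beta> x y)" if "y \<in> Y" for y
    unfolding \<beta>_def using Y(1) that by (intro continuous_intros cont) auto
  have "continuous_on K h"
    unfolding h_def \<sigma>_def
    using cont_\<beta> \<sigma>_pos by (intro continuous_intros) (force simp: \<sigma>_def)+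
  moreover have "h \<in> K \<rightarrow> K"
    unfolding h_def using Y weights \<sigma>_pos \<beta>_nonneg K(2)
    by (intro Pi_I convex_sum) (auto simp: less_imp_le)
  ultimately obtain x where x: "x \<in> K" "h x = x"
    using brouwer[OF K] by metis
  \<comment> \<open>Members of \<open>Y\<close> with weight zero may fail \<phi> x y > 0, so they
    are dropped before convexity of the set of such \<open>y\<close> is used. The fact
    \<open>drop\<close> is needed twice, for the real weights and for the weighted vectors.\<close>
  define Z where "Z = {y \<in> Y. \<phi> x y > 0}"
  have drop: "(\<Sum>y\<in>Y. g y) = (\<Sum>y\<in>Z. g y)" if "\<And>y. \<phi> x y \<le> 0 \<Longrightarrow> g y = 0"
    for g :: "'a \<Rightarrow> 'b::comm_monoid_add"
    using \<open>finite Y\<close> that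
    by (intro sum.mono_neutral_right) (auto simp: Z_def not_less)
  have "(\<Sum>y\<in>Z. (\<beta> x y / \<sigma> x) *\<^sub>R y) \<in> {y \<in> K. \<phi> x y > 0}"
  proof (rule convex_sum)
    show "(\<Sum>y\<in>Z. \<beta> x y / \<sigma> x) = 1"
      using weights[OF x(1)] drop[of "\<lambda>y. \<beta> x y / \<sigma> x"] by (simp add: \<beta>_def)
  qed (use Y conv[OF x(1)] \<sigma>_pos[OF x(1)] \<beta>_nonneg in \<open>auto simp: Z_def less_imp_le\<close>)
  moreover have "(\<Sum>y\<in>Z. (\<beta> x y / \<sigma> x) *\<^sub>R y) = x"
    using x(2) drop[of "\<lambda>y. (\<beta> x y / \<sigma> x) *\<^sub>R y"] by (simp add: h_def \<beta>_def)
  ultimately show False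
    using diag[OF x(1)] by simp
qed

text \<open>Brouwer's theorem is used in a Euclidean space, so profiles become vectors indexed by
  agents; the product of the strategy sets is then compact by Heine-Borel.\<close>

lemma compact_vec_Pi:
  fixes S :: "'n::finite \<Rightarrow> 'a::euclidean_space set"
  assumes "\<And>i. compact (S i)"
  shows "compact {z :: 'a ^ 'n. \<forall>i. z $ i \<in> S i}"
proof -
  have "\<exists>B. \<forall>y\<in>S i. norm y \<le> B" for i
    using compact_imp_bounded[OF assms] by (simp add: bounded_iff)
  then obtain B where B: "\<And>i y. y \<in> S i \<Longrightarrow> norm y \<le> B i"
    by metis
  have "norm z \<le> sum B UNIV" if "\<forall>i. z $ i \<in> S i" for z :: "'a ^ 'n"
  proof -
    have "norm z \<le> (\<Sum>i\<in>UNIV. norm (z $ i))"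
      unfolding norm_vec_def by (rule L2_set_le_sum) simp
    also have "\<dots> \<le> sum B UNIV"
      using that B by (intro sum_mono) auto
    finally show ?thesis .
  qed
  then have "bounded {z :: 'a ^ 'n. \<forall>i. z $ i \<in> S i}"
    by (auto simp: bounded_iff)
  moreover have "closed {z :: 'a ^ 'n. z $ i \<in> S i}" for i
    using closed_vimage[OF compact_imp_closed[OF assms[of i]], of "\<lambda>z. z $ i"]
    by (simp add: vimage_def continuous_on_component)
  then have "closed {z :: 'a ^ 'n. \<forall>i. z $ i \<in> S i}"
    by (rule closed_Collect_all)
  ultimately show ?thesis
    by (simp add: compact_eq_bounded_closed)
qed

text \<open>Ky Fan's inequality is applied to \<open>\<Phi> x y - \<Phi> x x\<close>, which vanishes
  on the diagonal. Each summand of \<Phi> x y involves a single coordinate of \<open>y\<close>, so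
  concavity in the own decision is enough for \<Phi> x to be concave.\<close>

theorem concave_game_has_equilibrium:
  fixes S :: "'f::finite \<Rightarrow> 's::euclidean_space set" and \<theta> :: "'f \<Rightarrow> ('f \<Rightarrow> 's) \<Rightarrow> real"
  assumes S: "\<And>f. compact (S f)" "\<And>f. convex (S f)" "\<And>f. S f \<noteq> {}"
    and cont: "\<And>f. continuous_on (Pi UNIV S) (\<theta> f)"
    and conc: "\<And>f x. x \<in> Pi UNIV S \<Longrightarrow> concave_on (S f) (\<lambda>y. \<theta> f (x(f := y)))"
  shows "\<exists>x. pure_nash_equilibrium S \<theta> x"
proof -
  define K where "K = {z :: 's ^ 'f. \<forall>f. z $ f \<in> S f}"
  define \<Phi> where "\<Phi> x y = (\<Sum>f\<in>UNIV. \<theta> f ((($) x)(f := y $ f)))" for x y :: "'s ^ 'f"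
  have upd: "(($) x)(f := y) \<in> Pi UNIV S" if "x \<in> K" "y \<in> S f" for x f y
    using that by (auto simp: K_def)
  have "compact K"
    unfolding K_def by (intro compact_vec_Pi S)
  moreover have "convex K"
    using S(2) by (auto simp: K_def convex_def)
  moreover have "K \<noteq> {}"
  proof -
    have "(\<chi> f. SOME y. y \<in> S f) \<in> K"
      using S(3) by (auto simp: K_def some_in_eq)
    then show ?thesis by auto
  qed
  moreover have "continuous_on K (\<lambda>x. \<Phi> x y - \<Phi> x x)" if "y \<in> K" for y
  proof -
    \<comment> \<open>A constant \<open>r\<close> gives the terms of \<Phi> x y, and the projection
      to coordinate \<open>f\<close> those of \<Phi> x x.\<close>
    have *: "continuous_on K (\<lambda>x. \<theta> f ((($) x)(f := r x)))"
      if "continuous_on K r" "r ` K \<subseteq> S f" for r f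
    proof (rule continuous_on_compose2[OF cont])
      show "continuous_on K (\<lambda>x. (($) x)(f := r x))"
      proof (rule continuous_on_coordinatewise_then_product)
        show "continuous_on K (\<lambda>x. ((($) x)(f := r x)) g)" for g
          using that(1) by (cases "g = f") (auto intro!: continuous_intros)
      qed
    qed (use upd that in blast)
    show ?thesis
      unfolding \<Phi>_def using \<open>y \<in> K\<close>
      by (intro continuous_intros *) (auto simp: K_def)
  qed
  moreover have "convex {y \<in> K. \<Phi> x y - \<Phi> x x > 0}" if x: "x \<in> K" for x
  proof -
    have "concave_on K (\<lambda>y. \<theta> f ((($) x)(f := y $ f)))" for f
      using conc[of "($) x" f] x \<open>convex K\<close> unfolding concave_on_iff by (auto simp: K_def)
    then have conc: "concave_on K (\<Phi> x)"
      unfolding \<Phi>_def concave_on_iff using \<open>convex K\<close>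
      by (auto simp: sum_distrib_left simp flip: sum.distrib intro!: sum_mono)
    show ?thesis
    proof (rule convexI)
      fix y z and u v :: real
      assume *: "y \<in> {y \<in> K. \<Phi> x y - \<Phi> x x > 0}" "z \<in> {y \<in> K. \<Phi> x y - \<Phi> x x > 0}"
        "0 \<le> u" "0 \<le> v" "u + v = 1"
      \<comment> \<open>Negation turns the strict upper bound for convex combinations into a lower
        bound.\<close>
      have "\<Phi> x x < u * \<Phi> x y + v * \<Phi> x z"
        using convex_bound_lt[of "- \<Phi> x y" "- \<Phi> x x" "- \<Phi> x z" u v] * by simp
      also have "\<dots> \<le> \<Phi> x (u *\<^sub>R y + v *\<^sub>R z)"
        using conc * unfolding concave_on_iff by auto
      finally show "u *\<^sub>R y + v *\<^sub>R z \<in> {y \<in> K. \<Phi> x y - \<Phi> x x > 0}"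
        using \<open>convex K\<close> * by (auto simp: convex_def)
    qed
  qed
  ultimately obtain x where x: "x \<in> K" and max: "\<And>y. y \<in> K \<Longrightarrow> \<Phi> x y \<le> \<Phi> x x"
    using Ky_Fan_inequality[of K "\<lambda>x y. \<Phi> x y - \<Phi> x x"] by auto
  have "\<theta> f ((($) x)(f := y)) \<le> \<theta> f (($) x)" if y: "y \<in> S f" for f y
  proof -
    \<comment> \<open>A unilateral deviation: \<open>z\<close> differs from \<open>x\<close> only at
      \<open>f\<close>, so the terms of all other agents cancel in
      \<open>\<Phi> x z \<le> \<Phi> x x\<close>.\<close>
    define z where "z = (\<chi> g. if g = f then y else x $ g)"
    have "z \<in> K"
      using x y by (auto simp: z_def K_def)
    have "(($) x)(g := z $ g) = (if g = f then (($) x)(f := y) else ($) x)" for g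
      by (auto simp: z_def)
    then have "\<Phi> x z = \<theta> f ((($) x)(f := y)) + (\<Sum>g\<in>UNIV - {f}. \<theta> g (($) x))"
      unfolding \<Phi>_def by (subst sum.remove[of _ f]) (auto intro!: sum.cong)
    moreover have "\<Phi> x x = \<theta> f (($) x) + (\<Sum>g\<in>UNIV - {f}. \<theta> g (($) x))"
      unfolding \<Phi>_def by (subst sum.remove[of _ f]) auto
    ultimately show ?thesis
      using max[OF \<open>z \<in> K\<close>] by simp
  qed
  then have "pure_nash_equilibrium S \<theta> (($) x)"
    using x by (auto simp: pure_nash_equilibrium_def is_arg_max_def K_def not_less)
  then show ?thesis by (rule exI[where x = "($) x"])
qed

lemma continuous_on_Min:
  fixes f :: "'i \<Rightarrow> 'a::topological_space \<Rightarrow> real"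
  assumes "finite I" "I \<noteq> {}" "\<And>i. i \<in> I \<Longrightarrow> continuous_on S (f i)"
  shows "continuous_on S (\<lambda>x. Min ((\<lambda>i. f i x) ` I))"
  using assms by (induction I rule: finite_ne_induct) (auto intro!: continuous_intros)

text \<open>A minimum lies below each of its entries, so concavity of the entry with index
  \<open>i\<close> yields the bound for every \<open>i\<close>, hence for their minimum.\<close>

lemma concave_on_Min:
  fixes f :: "'i \<Rightarrow> 'a::real_vector \<Rightarrow> real"
  assumes I: "finite I" "I \<noteq> {}" and conc: "\<And>i. i \<in> I \<Longrightarrow> concave_on S (f i)"
  shows "concave_on S (\<lambda>x. Min ((\<lambda>i. f i x) ` I))"
  unfolding concave_on_iff
proof (intro conjI ballI allI impI)
  show "convex S"
    using I conc by (auto simp: concave_on_iff)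
next
  fix x y and u v :: real
  assume *: "x \<in> S" "y \<in> S" "0 \<le> u" "0 \<le> v" "u + v = 1"
  have "u * Min ((\<lambda>i. f i x) ` I) + v * Min ((\<lambda>i. f i y) ` I) \<le> f i (u *\<^sub>R x + v *\<^sub>R y)"
    if "i \<in> I" for i
  proof -
    have "u * Min ((\<lambda>i. f i x) ` I) + v * Min ((\<lambda>i. f i y) ` I) \<le> u * f i x + v * f i y"
      using I that * by (intro add_mono mult_left_mono) auto
    also have "\<dots> \<le> f i (u *\<^sub>R x + v *\<^sub>R y)"
      using conc[OF that] * by (auto simp: concave_on_iff)
    finally show ?thesis .
  qed
  then show "u * Min ((\<lambda>i. f i x) ` I) + v * Min ((\<lambda>i. f i y) ` I)
      \<le> Min ((\<lambda>i. f i (u *\<^sub>R x + v *\<^sub>R y)) ` I)"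
    using I by simp
qed

text \<open>Distinct vertices leave finitely many paths, so \<open>Min\<close> in
  \<open>payoff\<close> is a genuine minimum.\<close>

lemma finite_st_paths:
  assumes "pair_fin_digraph G"
  shows "finite (st_paths G s t)"
proof -
  interpret pair_fin_digraph G by fact
  show ?thesis
    unfolding st_paths_def by (rule apaths_finite)
qed

lemma continuous_on_payoff:
  assumes "pair_fin_digraph G" "st_paths G (s f) (t f) \<noteq> {}"
  shows "continuous_on S (payoff G d0 s t f)"
proof -
  have "continuous_on S (\<lambda>x. \<Sum>a\<leftarrow>p. d0 a + (\<Sum>g\<in>UNIV. x g $ a))" for p
  proof (induction p)
    case (Cons a p)
    have "continuous_on S (\<lambda>x. x g)" for g
      by (rule continuous_on_subset[OF continuous_on_product_coordinates]) simp
    with Cons show ?case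
      by (auto intro!: continuous_intros)
  qed simp
  then show ?thesis
    unfolding payoff_def using assms by (intro continuous_on_Min finite_st_paths)
qed

lemma concave_on_payoff:
  assumes "pair_fin_digraph G" "st_paths G (s f) (t f) \<noteq> {}" "convex S"
  shows "concave_on S (\<lambda>y. payoff G d0 s t f (x(f := y)))"
proof -
  have "concave_on S (\<lambda>y. \<Sum>a\<leftarrow>p. d0 a + (\<Sum>g\<in>UNIV. (x(f := y)) g $ a))" for p
  proof -
    \<comment> \<open>The length of an arc before agent \<open>f\<close> interdicts it; with the
      other agents fixed, every path length is affine in \<open>y\<close>.\<close>
    define C where "C a = d0 a + (\<Sum>g\<in>UNIV - {f}. x g $ a)" for a
    have "(\<Sum>g\<in>UNIV. (x(f := y)) g $ a) = y $ a + (\<Sum>g\<in>UNIV - {f}. x g $ a)" for a y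
      by (subst sum.remove[of _ f]) auto
    then have eq: "(\<Sum>a\<leftarrow>p. d0 a + (\<Sum>g\<in>UNIV. (x(f := y)) g $ a)) = (\<Sum>a\<leftarrow>p. C a + y $ a)" for y
      by (simp add: C_def ac_simps)
    have "(\<Sum>a\<leftarrow>p. C a + (u *\<^sub>R y + v *\<^sub>R z) $ a)
        = u * (\<Sum>a\<leftarrow>p. C a + y $ a) + v * (\<Sum>a\<leftarrow>p. C a + z $ a)"
      if "u + v = 1" for u v y z
    proof (induction p)
      case (Cons a p)
      \<comment> \<open>The constant part splits because the weights sum to one; this is where
        affine rather than linear matters.\<close>
      have "C a = u * C a + v * C a"
        using that by (simp flip: distrib_right)
      with Cons show ?case
        by (simp add: algebra_simps)
    qed simp
    then show ?thesis
      unfolding eq concave_on_iff using \<open>convex S\<close> by simp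
  qed
  then show ?thesis
    unfolding payoff_def using assms by (intro concave_on_Min finite_st_paths)
qed

text \<open>With the costs extended by zero off the arc set, the budget constraint is a closed
  half-space, so convexity and compactness pass from \<open>X f\<close> to the feasible set.\<close>

lemma feasible_eq_Int_halfspace:
  "feasible G c b X f = X f \<inter> {y. (\<chi> a. if a \<in> parcs G then c f a else 0) \<bullet> y \<le> b f}"
  by (simp add: feasible_def Int_def inner_vec_def if_distrib[of "\<lambda>z. z * _"] sum.If_cases)

theorem proposition1:
  fixes G :: "('v :: finite) pair_pre_digraph"
    and d0 :: "'v \<times> 'v \<Rightarrow> real"
    and s t :: "'f :: finite \<Rightarrow> 'v"
    and b :: "'f \<Rightarrow> real"
    and c :: "'f \<Rightarrow> 'v \<times> 'v \<Rightarrow> real"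
    and X :: "'f \<Rightarrow> (real ^ ('v \<times> 'v)) set"
  assumes "pair_fin_digraph G"
    and "\<And>f. s f \<in> pverts G"
    and "\<And>f. t f \<in> pverts G"
    and "\<And>f. st_paths G (s f) (t f) \<noteq> {}"
    and "\<And>f. b f > 0"
    and "\<And>f a. a \<in> parcs G \<Longrightarrow> c f a > 0"
    and "\<And>a. a \<in> parcs G \<Longrightarrow> d0 a > 0"
    and "\<And>f. X f \<subseteq> arc_vectors (parcs G)"
    and "\<And>f. X f \<noteq> {}"
    and "\<And>f. convex (X f)"
    and "\<And>f. compact (X f)"
    and "\<And>f. feasible G c b X f \<noteq> {}"
  shows "\<exists>x. pure_nash_equilibrium (feasible G c b X) (payoff G d0 s t) x"
proof (rule concave_game_has_equilibrium)
  show conv: "convex (feasible G c b X f)" for f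
    unfolding feasible_eq_Int_halfspace by (intro convex_Int convex_halfspace_le assms)
  show "compact (feasible G c b X f)" for f
    unfolding feasible_eq_Int_halfspace by (intro compact_Int_closed closed_halfspace_le assms)
  show "feasible G c b X f \<noteq> {}" for f
    by fact
  show "continuous_on (Pi UNIV (feasible G c b X)) (payoff G d0 s t f)" for f
    by (intro continuous_on_payoff assms)
  show "concave_on (feasible G c b X f) (\<lambda>y. payoff G d0 s t f (x(f := y)))" for f x
    by (intro concave_on_payoff assms conv)
qed

end
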